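(* Let $G$ be a connected graph of order $n\geq 3$. Then $\operatorname{car}(G)=n-1$ if and only if $G$ is isomorphic to the cycle $C_n$.
   Context: All graphs are finite, simple and undirected; $G[X]$ denotes the subgraph induced by $X$. A set $S\subseteq V(G)$ is cycle convex if for every $u\in V(G)\setminus S$ the graph $G[S\cup\{u\}]$ contains no cycle passing through $u$. The cycle convex hull $\langle S\rangle$ is the smallest cycle convex set containing $S$. A set $S$ is Carathéodory independent if there is $p\in\langle S\rangle$ with $p\notin \bigcup_{a\in S}\langle S\setminus\{a\}\rangle$. The Carathéodory number $\operatorname{car}(G)$ is the maximum cardinality of a Carathéodory independent set of $G$. *)

theory Defs
  imports
    "Graph_Theory.Digraph_Component"
    "Graph_Theory.Digraph_Isomorphism"
begin

text \<open>
  Undirected graphs are symmetric digraphs, so a single edge gives a closed walk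
  \<open>u, v, u\<close> that counts as a \<^const>\<open>pre_digraph.cycle\<close>; the bound on the length excludes it.
  The vertices of a closed walk are the tails of its arcs.
\<close>
definition cycle_through :: "('a, 'b) pre_digraph \<Rightarrow> 'a \<Rightarrow> bool" where
  "cycle_through H u \<longleftrightarrow>
     (\<exists>p. pre_digraph.cycle H p \<and> 3 \<le> length p \<and> u \<in> tail H ` set p)"

definition cycle_convex :: "('a, 'b) pre_digraph \<Rightarrow> 'a set \<Rightarrow> bool" where
  "cycle_convex G S \<longleftrightarrow>
     S \<subseteq> verts G \<and> (\<forall>u \<in> verts G - S. \<not> cycle_through (G \<restriction> (S \<union> {u})) u)"

definition cycle_hull :: "('a, 'b) pre_digraph \<Rightarrow> 'a set \<Rightarrow> 'a set" where
  "cycle_hull G S = \<Inter> {C. cycle_convex G C \<and> S \<subseteq> C}"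

definition caratheodory_independent :: "('a, 'b) pre_digraph \<Rightarrow> 'a set \<Rightarrow> bool" where
  "caratheodory_independent G S \<longleftrightarrow>
     S \<subseteq> verts G \<and> (\<exists>p \<in> cycle_hull G S. p \<notin> (\<Union>a \<in> S. cycle_hull G (S - {a})))"

definition caratheodory_number :: "('a, 'b) pre_digraph \<Rightarrow> nat" where
  "caratheodory_number G = Max (card ` {S. caratheodory_independent G S})"

definition cycle_graph :: "nat \<Rightarrow> nat pair_pre_digraph" where
  "cycle_graph n =
     \<lparr> pverts = {..<n},
       parcs = {(i, j). i < n \<and> j < n \<and> (j = (i + 1) mod n \<or> i = (j + 1) mod n)} \<rparr>"

lemma cycle_through_induce_mono:
  assumes "wf_digraph G" "cycle_through (G \<restriction> X) u" "X \<subseteq> Y"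
  shows "cycle_through (G \<restriction> Y) u"
proof -
  interpret wf_digraph G by fact
  have av: "pre_digraph.awalk_verts (G \<restriction> Z) = awalk_verts" for Z
    by (rule awalk_verts_induce)
  have "pre_digraph.cas (G \<restriction> Z) v p w = cas v p w" for Z v p w
    by (induction p arbitrary: v)
      (simp_all add: pre_digraph.cas.simps induce_subgraph_tail induce_subgraph_head)
  with av show ?thesis
    using assms(2,3) unfolding cycle_through_def pre_digraph.cycle_def pre_digraph.awalk_def
    by (simp add: induce_subgraph_arcs induce_subgraph_tail) blast
qed

lemma cycle_convex_verts: "cycle_convex G (verts G)"
  by (simp add: cycle_convex_def)

text \<open>The intersection defining the hull is indeed the smallest cycle convex superset.\<close>

lemma cycle_convex_hull:
  assumes "wf_digraph G" "S \<subseteq> verts G"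
  shows "cycle_convex G (cycle_hull G S)"
  unfolding cycle_convex_def
proof safe
  fix x assume "x \<in> cycle_hull G S"
  then show "x \<in> verts G"
    using cycle_convex_verts[of G] assms(2) unfolding cycle_hull_def by blast
next
  fix u assume u: "u \<in> verts G" "u \<notin> cycle_hull G S"
    and cyc: "cycle_through (G \<restriction> (cycle_hull G S \<union> {u})) u"
  from u obtain C where C: "cycle_convex G C" "S \<subseteq> C" "u \<notin> C"
    unfolding cycle_hull_def by blast
  then have "cycle_hull G S \<union> {u} \<subseteq> C \<union> {u}" unfolding cycle_hull_def by blast
  from cycle_through_induce_mono[OF assms(1) cyc this] C u(1) show False
    unfolding cycle_convex_def by blast
qed

lemma subset_cycle_hull: "S \<subseteq> cycle_hull G S"
  unfolding cycle_hull_def by blast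

lemma cycle_hull_least: "cycle_convex G C \<Longrightarrow> S \<subseteq> C \<Longrightarrow> cycle_hull G S \<subseteq> C"
  unfolding cycle_hull_def by blast

lemma pair_graph_cycle_graph:
  assumes "3 \<le> n"
  shows "pair_graph (cycle_graph n)"
proof -
  have "finite (parcs (cycle_graph n))"
    by (rule finite_subset[of _ "{..<n} \<times> {..<n}"]) (auto simp: cycle_graph_def)
  moreover have "Suc i mod n \<noteq> i \<and> i \<noteq> Suc i mod n" if "i < n" for i
    using that assms by (cases "Suc i = n") auto
  ultimately show ?thesis
    by unfold_locales (fastforce simp: cycle_graph_def symmetric_def sym_def)+
qed

end

theory Submission
  imports Defs
begin

text \<open>
  An independent set \<open>S\<close> of order \<open>n - 1\<close> omits exactly one vertex \<open>p\<close>, and \<open>p\<close> is the point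
  witnessing independence. As \<open>p\<close> lies in the hull of \<open>S\<close>, some cycle passes through \<open>p\<close>; a cycle
  through \<open>p\<close> missing a vertex \<open>a\<close> would put \<open>p\<close> into the hull of \<open>S - {a}\<close>. So every cycle through
  \<open>p\<close> is Hamiltonian. A chord of such a cycle would shortcut it to a shorter one still passing
  through \<open>p\<close>, hence the cycle is all of \<open>G\<close>. Conversely, no proper vertex subset of \<open>C\<^sub>n\<close> carries a
  cycle, because the vertex set of a cycle in a 2-regular graph is closed under taking neighbours;
  so all vertices but one form an independent set.
\<close>

section \<open>Cycles as cyclic sequences of vertices\<close>

text \<open>An arc of a \<open>pair_pre_digraph\<close> is the pair of its ends, so the vertices
  alone determine a cycle. Indexing them modulo \<open>k\<close> turns rotations and shortcuts into
  index arithmetic.\<close>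

definition vertex_cycle :: "'a rel \<Rightarrow> nat \<Rightarrow> (nat \<Rightarrow> 'a) \<Rightarrow> bool" where
  "vertex_cycle E k f \<longleftrightarrow> 3 \<le> k \<and> inj_on f {..<k} \<and> (\<forall>i<k. (f i, f (Suc i mod k)) \<in> E)"

lemma with_proj_induce_subgraph:
  "with_proj G \<restriction> X =
     with_proj \<lparr>pverts = X, parcs = {e \<in> parcs G. fst e \<in> X \<and> snd e \<in> X}\<rparr>"
  by (simp add: induce_subgraph_def with_proj_def)

lemma pcas_iff_nth:
  assumes "p \<noteq> []"
  shows "pcas u p v \<longleftrightarrow> fst (p ! 0) = u \<and> snd (last p) = v \<and>
           (\<forall>i. Suc i < length p \<longrightarrow> snd (p ! i) = fst (p ! Suc i))"
  using assms
proof (induction p arbitrary: u)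
  case (Cons e p)
  show ?case
  proof (cases "p = []")
    case False
    then have "(\<forall>i. Suc i < length (e # p) \<longrightarrow> snd ((e # p) ! i) = fst ((e # p) ! Suc i)) \<longleftrightarrow>
        snd e = fst (p ! 0) \<and> (\<forall>i. Suc i < length p \<longrightarrow> snd (p ! i) = fst (p ! Suc i))"
      by (auto simp: nth_Cons less_Suc_eq_0_disj split: nat.splits)
    with Cons.IH[OF False] False show ?thesis by auto
  qed auto
qed simp

text \<open>The predicate \<open>cycle\<close> asks for distinctness of this tail; here it becomes
  distinctness of the heads of the arcs.\<close>

lemma tl_pawalk_verts: "pcas u p v \<Longrightarrow> tl (pawalk_verts u p) = map snd p"
proof (induction p arbitrary: u)
  case (Cons e p)
  then have "pcas (snd e) p v" by simp
  moreover from this have "pawalk_verts (snd e) p = snd e # tl (pawalk_verts (snd e) p)"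
    by (cases p) auto
  ultimately show ?case using Cons.IH by simp
qed simp

text \<open>\<open>cycle_through\<close> lets the given vertex sit anywhere on the closed walk; a
  rotation brings it to index 0.\<close>

lemma vertex_cycle_rotate:
  assumes "vertex_cycle E k f" "m < k"
  shows "vertex_cycle E k (\<lambda>i. f ((i + m) mod k))"
proof -
  have k: "3 \<le> k" and inj: "inj_on f {..<k}" and E: "\<And>i. i < k \<Longrightarrow> (f i, f (Suc i mod k)) \<in> E"
    using assms unfolding vertex_cycle_def by auto
  have "inj_on (\<lambda>i. (i + m) mod k) {..<k}"
  proof (rule inj_onI)
    fix i j assume "i \<in> {..<k}" "j \<in> {..<k}" "(i + m) mod k = (j + m) mod k"
    then show "i = j"
      using assms(2) by (auto simp: mod_if split: if_splits)
  qed
  moreover have "inj_on f ((\<lambda>i. (i + m) mod k) ` {..<k})"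
    by (rule inj_on_subset[OF inj]) (use k in auto)
  ultimately have "inj_on (\<lambda>i. f ((i + m) mod k)) {..<k}"
    using comp_inj_on[of "\<lambda>i. (i + m) mod k" "{..<k}" f] by (simp add: comp_def)
  moreover have "(f ((i + m) mod k), f ((Suc i mod k + m) mod k)) \<in> E" for i
    using E[of "(i + m) mod k"] k by (simp add: mod_Suc_eq mod_add_left_eq)
  ultimately show ?thesis
    using k unfolding vertex_cycle_def by blast
qed

text \<open>The arc list of a cycle and the sequence of its tails determine each other, since each
  head is the next tail. All later arguments about cycles pass through this translation.\<close>

lemma cycle_through_induce_iff:
  "cycle_through (with_proj G \<restriction> X) u \<longleftrightarrow>
     (\<exists>k f. vertex_cycle (parcs G) k f \<and> f ` {..<k} \<subseteq> X \<and> f 0 = u)"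
proof
  assume "cycle_through (with_proj G \<restriction> X) u"
  then obtain p w where p: "set p \<subseteq> {e \<in> parcs G. fst e \<in> X \<and> snd e \<in> X}" "pcas w p w"
      "distinct (tl (pawalk_verts w p))" "3 \<le> length p" "u \<in> fst ` set p"
    unfolding cycle_through_def pre_digraph.cycle_def pre_digraph.awalk_def
      with_proj_induce_subgraph cas_with_proj_eq awalk_verts_with_proj_eq by auto
  define k where "k = length p"
  define f where "f i = fst (p ! i)" for i
  have k: "3 \<le> k" "p \<noteq> []" using p(4) by (auto simp: k_def)
  have c: "fst (p ! 0) = w" "snd (last p) = w"
      "\<And>i. Suc i < length p \<Longrightarrow> snd (p ! i) = fst (p ! Suc i)"
    using p(2) pcas_iff_nth[OF k(2)] by auto
  \<comment> \<open>Heads are tails shifted by one; closedness of the walk accounts for the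
    wrap-around at the last arc.\<close>
  have s: "snd (p ! i) = f (Suc i mod k)" if "i < k" for i
  proof (cases "Suc i = k")
    case True
    then have "last p = p ! i" using k(2) by (metis diff_Suc_1 k_def last_conv_nth)
    with True c show ?thesis by (simp add: f_def)
  next
    case False
    with that c(3)[of i] show ?thesis by (simp add: f_def k_def)
  qed
  \<comment> \<open>The walk provides distinct heads, whereas \<open>f\<close> lists tails. The
    \<open>k\<close> distinct heads all occur among the tails, so \<open>f\<close> takes at least
    \<open>k\<close> values on \<open>k\<close> indices.\<close>
  have inj: "inj_on f {..<k}"
  proof -
    have "distinct (map snd p)" using p(2,3) by (simp add: tl_pawalk_verts)
    then have d: "inj_on (\<lambda>i. snd (p ! i)) {..<k}"
      by (auto simp: distinct_conv_nth k_def inj_on_def)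
    have "card ((\<lambda>i. f (Suc i mod k)) ` {..<k}) = k"
      using card_image[OF d] s by (simp cong: image_cong_simp)
    moreover have "(\<lambda>i. f (Suc i mod k)) ` {..<k} \<subseteq> f ` {..<k}" using k by auto
    ultimately have "k \<le> card (f ` {..<k})" by (metis card_mono finite_imageI finite_lessThan)
    then show ?thesis
      using card_image_le[of "{..<k}" f] by (intro eq_card_imp_inj_on) auto
  qed
  have "(f i, f (Suc i mod k)) \<in> parcs G \<and> f i \<in> X" if "i < k" for i
  proof -
    have "p ! i = (f i, f (Suc i mod k))" using s[OF that] by (simp add: f_def prod_eq_iff)
    moreover have "p ! i \<in> set p" using that by (simp add: k_def)
    ultimately show ?thesis using p(1) by auto
  qed
  then have vc: "vertex_cycle (parcs G) k f" and X: "\<And>i. i < k \<Longrightarrow> f i \<in> X"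
    using k inj unfolding vertex_cycle_def by auto
  obtain m where m: "m < k" "u = f m"
    using p(5) by (auto simp: k_def f_def in_set_conv_nth)
  show "\<exists>k f. vertex_cycle (parcs G) k f \<and> f ` {..<k} \<subseteq> X \<and> f 0 = u"
    using vertex_cycle_rotate[OF vc m(1)] X m
    by (intro exI[of _ k] exI[of _ "\<lambda>i. f ((i + m) mod k)"]) auto
next
  assume "\<exists>k f. vertex_cycle (parcs G) k f \<and> f ` {..<k} \<subseteq> X \<and> f 0 = u"
  then obtain k f where k: "3 \<le> k" and inj: "inj_on f {..<k}"
    and E: "\<And>i. i < k \<Longrightarrow> (f i, f (Suc i mod k)) \<in> parcs G"
    and X: "\<And>i. i < k \<Longrightarrow> f i \<in> X" and u: "f 0 = u"
    unfolding vertex_cycle_def image_subset_iff lessThan_iff by blast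
  define p where "p = map (\<lambda>i. (f i, f (Suc i mod k))) [0..<k]"
  have p: "length p = k" "p \<noteq> []" "\<And>i. i < k \<Longrightarrow> p ! i = (f i, f (Suc i mod k))"
    using k by (auto simp: p_def)
  have cas: "pcas u p u"
    unfolding pcas_iff_nth[OF p(2)] using p k u by (auto simp: last_conv_nth)
  have "inj_on (\<lambda>i. Suc i mod k) {..<k}"
    by (rule inj_onI) (auto simp: mod_Suc split: if_splits)
  moreover have "inj_on f ((\<lambda>i. Suc i mod k) ` {..<k})"
    by (rule inj_on_subset[OF inj]) (use k in auto)
  ultimately have "inj_on (\<lambda>i. f (Suc i mod k)) {..<k}"
    using comp_inj_on[of "\<lambda>i. Suc i mod k" "{..<k}" f] by (simp add: comp_def)
  then have d: "distinct (map snd p)"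
    by (simp add: p_def distinct_map comp_def lessThan_atLeast0)
  have "set p \<subseteq> {e \<in> parcs G. fst e \<in> X \<and> snd e \<in> X}"
    using E X k by (auto simp: p_def)
  moreover have "u \<in> X" using X[of 0] k u by auto
  moreover have "u \<in> fst ` set p" using k u by (force simp: p_def)
  ultimately show "cycle_through (with_proj G \<restriction> X) u"
    unfolding cycle_through_def pre_digraph.cycle_def pre_digraph.awalk_def
      with_proj_induce_subgraph cas_with_proj_eq awalk_verts_with_proj_eq
    using cas d p k by (auto simp: tl_pawalk_verts intro!: exI[of _ p] exI[of _ u])
qed

section \<open>Isomorphism with the cycle graph\<close>

text \<open>An isomorphism of the library carries its own arc map and its own head and tail
  functions. Between pair digraphs these are forced by the vertex map.\<close>

lemma digraph_iso_with_proj_iff: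
  assumes "pair_wf_digraph H"
  shows "digraph_iso (with_proj H) (with_proj G) \<longleftrightarrow>
           (\<exists>\<phi>. inj_on \<phi> (pverts H) \<and> pverts G = \<phi> ` pverts H \<and>
                parcs G = map_prod \<phi> \<phi> ` parcs H)"
proof
  assume "digraph_iso (with_proj H) (with_proj G)"
  then obtain h where h: "pre_digraph.digraph_isomorphism (with_proj H) h"
      and G: "with_proj G = app_iso h (with_proj H)"
    unfolding digraph_iso_def by blast
  have GV: "pverts G = iso_verts h ` pverts H" and GA: "parcs G = iso_arcs h ` parcs H"
    and GT: "iso_tail h = fst" and GH: "iso_head h = snd"
    using arg_cong[OF G, of verts] arg_cong[OF G, of arcs]
      arg_cong[OF G, of tail] arg_cong[OF G, of head] by auto
  have "iso_arcs h a = map_prod (iso_verts h) (iso_verts h) a" if "a \<in> parcs H" for a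
    using h that GT GH by (cases a) (auto simp: pre_digraph.digraph_isomorphism_def prod_eq_iff)
  then have "parcs G = map_prod (iso_verts h) (iso_verts h) ` parcs H"
    using GA by (simp cong: image_cong)
  with GV h show "\<exists>\<phi>. inj_on \<phi> (pverts H) \<and> pverts G = \<phi> ` pverts H \<and>
                parcs G = map_prod \<phi> \<phi> ` parcs H"
    by (auto simp: pre_digraph.digraph_isomorphism_def)
next
  assume "\<exists>\<phi>. inj_on \<phi> (pverts H) \<and> pverts G = \<phi> ` pverts H \<and> parcs G = map_prod \<phi> \<phi> ` parcs H"
  then obtain \<phi> where \<phi>: "inj_on \<phi> (pverts H)" "pverts G = \<phi> ` pverts H"
    "parcs G = map_prod \<phi> \<phi> ` parcs H" by blast
  define h where
    "h = \<lparr>iso_verts = \<phi>, iso_arcs = map_prod \<phi> \<phi>, iso_head = snd, iso_tail = fst\<rparr>"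
  interpret pair_wf_digraph H by fact
  have "inj_on (map_prod \<phi> \<phi>) (parcs H)"
    by (rule inj_on_subset[OF map_prod_inj_on[OF \<phi>(1) \<phi>(1)]]) (auto dest: wellformed')
  then have "pre_digraph.digraph_isomorphism (with_proj H) h"
    using \<phi>(1) assms by (auto simp: pre_digraph.digraph_isomorphism_def h_def wf_digraph_wp_iff)
  moreover have "with_proj G = app_iso h (with_proj H)"
    using \<phi> by (simp add: app_iso_def h_def with_proj_def)
  ultimately show "digraph_iso (with_proj H) (with_proj G)"
    unfolding digraph_iso_def by blast
qed

text \<open>The isomorphism is turned around, so that \<open>\<phi>\<close> labels the vertices of
  \<open>G\<close> by \<open>{..<n}\<close>.\<close>

lemma digraph_iso_cycle_graph_iff:
  assumes "pair_graph G" "3 \<le> n"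
  shows "digraph_iso (with_proj G) (with_proj (cycle_graph n)) \<longleftrightarrow>
           (\<exists>\<phi>. inj_on \<phi> {..<n} \<and> pverts G = \<phi> ` {..<n} \<and>
                parcs G = map_prod \<phi> \<phi> ` parcs (cycle_graph n))"
proof -
  interpret G: pair_graph G by fact
  interpret C: pair_graph "cycle_graph n" by (rule pair_graph_cycle_graph) fact
  have "digraph_iso (with_proj G) (with_proj (cycle_graph n)) \<longleftrightarrow>
      digraph_iso (with_proj (cycle_graph n)) (with_proj G)"
    using digraph_iso_swap[OF G.wf_digraph_axioms] digraph_iso_swap[OF C.wf_digraph_axioms] by auto
  then show ?thesis
    using digraph_iso_with_proj_iff[of "cycle_graph n" G] C.pair_wf_digraph_axioms
    by (simp add: cycle_graph_def)
qed

section \<open>Hulls and the bound on the order of independent sets\<close>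

text \<open>The cycle survives when \<open>S\<close> grows to its hull, so a vertex outside the hull
  would violate the convexity of the hull.\<close>

lemma cycle_through_hull:
  assumes "wf_digraph G" "S \<subseteq> verts G" "u \<in> verts G" "cycle_through (G \<restriction> (S \<union> {u})) u"
  shows "u \<in> cycle_hull G S"
proof (rule ccontr)
  assume "u \<notin> cycle_hull G S"
  moreover have "cycle_through (G \<restriction> (cycle_hull G S \<union> {u})) u"
    by (rule cycle_through_induce_mono[OF assms(1,4)]) (use subset_cycle_hull[of S G] in auto)
  ultimately show False
    using cycle_convex_hull[OF assms(1,2)] assms(3) unfolding cycle_convex_def by blast
qed

lemma cycle_hull_eq: "cycle_convex G S \<Longrightarrow> cycle_hull G S = S"
  by (simp add: cycle_hull_least subset_cycle_hull subset_antisym)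

lemma finite_caratheodory_independent:
  "finite (verts G) \<Longrightarrow> finite {S. caratheodory_independent G S}"
  by (rule finite_subset[of _ "Pow (verts G)"]) (auto simp: caratheodory_independent_def)

text \<open>No cycle fits into one vertex, so the hull of the empty set is empty. The lemma shows
  that the maximum defining \<open>caratheodory_number\<close> is taken over a nonempty set.\<close>

lemma caratheodory_independent_singleton:
  fixes G :: "'a pair_pre_digraph"
  assumes "v \<in> pverts G"
  shows "caratheodory_independent (with_proj G) {v}"
proof -
  have "\<not> cycle_through (with_proj G \<restriction> {u}) u" for u
  proof
    assume "cycle_through (with_proj G \<restriction> {u}) u"
    then obtain k :: nat and f where f: "3 \<le> k" "inj_on f {..<k}" "f ` {..<k} \<subseteq> {u}"
      unfolding cycle_through_induce_iff vertex_cycle_def by blast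
    then have "f 0 = f 1" by (auto simp: image_subset_iff)
    with f(1) inj_onD[OF f(2), of 0 1] show False by simp
  qed
  then have "cycle_hull (with_proj G) {} = {}"
    by (intro cycle_hull_eq) (simp add: cycle_convex_def)
  then show ?thesis
    using assms subset_cycle_hull[of "{v}" "with_proj G"]
    by (auto simp: caratheodory_independent_def)
qed

text \<open>A witness inside \<open>S\<close> would remain in \<open>S - {a}\<close> for any other
  element \<open>a\<close>, and hence in the hull of \<open>S - {a}\<close>.\<close>

lemma caratheodory_independent_witness:
  assumes "caratheodory_independent G S" "2 \<le> card S"
  obtains p where "p \<in> cycle_hull G S" "p \<notin> S" "\<And>a. a \<in> S \<Longrightarrow> p \<notin> cycle_hull G (S - {a})"
proof -
  obtain p where p: "p \<in> cycle_hull G S" "\<And>a. a \<in> S \<Longrightarrow> p \<notin> cycle_hull G (S - {a})"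
    using assms(1) unfolding caratheodory_independent_def by auto
  have "p \<notin> S"
  proof
    assume "p \<in> S"
    have "\<not> S \<subseteq> {p}" using card_mono[of "{p}" S] assms(2) by auto
    then obtain a where "a \<in> S" "a \<noteq> p" by blast
    with p(2)[of a] \<open>p \<in> S\<close> subset_cycle_hull[of "S - {a}" G] show False by blast
  qed
  with p that show thesis by blast
qed

text \<open>The full vertex set is its own hull, which leaves no room for a witness outside
  it.\<close>

lemma card_caratheodory_independent_less:
  assumes "finite (verts G)" "2 \<le> card (verts G)" "caratheodory_independent G S"
  shows "card S < card (verts G)"
proof -
  have S: "S \<subseteq> verts G" using assms(3) by (simp add: caratheodory_independent_def)
  have "S \<noteq> verts G"
  proof
    assume "S = verts G"
    with assms obtain p where "p \<in> cycle_hull G S" "p \<notin> S"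
      by (metis caratheodory_independent_witness)
    with \<open>S = verts G\<close> show False by (simp add: cycle_hull_eq cycle_convex_verts)
  qed
  with S assms(1) show ?thesis by (simp add: psubset_card_mono psubset_eq)
qed

text \<open>As \<open>n - 1\<close> bounds the order of every independent set, the maximum equals it
  exactly when it is attained.\<close>

lemma caratheodory_number_eq_card_minus_1_iff:
  fixes G :: "'a pair_pre_digraph"
  assumes "pair_graph G" "card (pverts G) = n" "2 \<le> n"
  shows "caratheodory_number (with_proj G) = n - 1 \<longleftrightarrow>
           (\<exists>S. caratheodory_independent (with_proj G) S \<and> card S = n - 1)"
proof -
  interpret pair_graph G by fact
  let ?C = "card ` {S. caratheodory_independent (with_proj G) S}"
  have fin: "finite ?C"
    using finite_caratheodory_independent[of "with_proj G"] pair_finite_verts by simp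
  obtain v where "v \<in> pverts G" using assms(2,3) by fastforce
  then have ne: "?C \<noteq> {}" using caratheodory_independent_singleton[of v G] by auto
  have "card S < n" if "caratheodory_independent (with_proj G) S" for S
    using card_caratheodory_independent_less[OF _ _ that] assms(2,3) pair_finite_verts by simp
  then have "x \<le> n - 1" if "x \<in> ?C" for x
    using that by fastforce
  then have "caratheodory_number (with_proj G) = n - 1 \<longleftrightarrow> n - 1 \<in> ?C"
    unfolding caratheodory_number_def using fin ne by (metis Max_in Max_eqI)
  also have "\<dots> \<longleftrightarrow> (\<exists>S. caratheodory_independent (with_proj G) S \<and> card S = n - 1)"
    by (auto simp: image_iff)
  finally show ?thesis .
qed

section \<open>From an independent set of order \<open>n - 1\<close> to the cycle\<close>

text \<open>The chord replaces the stretch strictly between \<open>i\<close> and \<open>j\<close>.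
  Index 0 is never skipped, so \<open>f 0\<close> stays on the cycle. The pair
  \<open>(0, k - 1)\<close> is the closing edge; a shortcut along it would have length 2.\<close>

lemma vertex_cycle_shortcut:
  assumes "vertex_cycle E k f" "i + 1 < j" "j < k" "(i, j) \<noteq> (0, k - 1)" "(f i, f j) \<in> E"
  obtains l g where "vertex_cycle E l g" "g 0 = f 0" "g ` {..<l} \<subseteq> f ` {..<k} - {f (Suc i)}"
proof -
  have inj: "inj_on f {..<k}" and E: "\<And>i. i < k \<Longrightarrow> (f i, f (Suc i mod k)) \<in> E"
    using assms(1) unfolding vertex_cycle_def by auto
  \<comment> \<open>\<open>s\<close> enumerates the indices that remain, jumping from
    \<open>i\<close> to \<open>j\<close>, and \<open>l\<close> is their number.\<close>
  define s where "s t = (if t \<le> i then t else t + (j - Suc i))" for t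
  define l where "l = k - (j - Suc i)"
  have l: "3 \<le> l" "Suc i < l" using assms(2-4) by (auto simp: l_def)
  have s_less: "s t < k" if "t < l" for t
    using that assms(2,3) by (auto simp: s_def l_def)
  have s_ne: "s t \<noteq> Suc i" for t
    using assms(2) by (auto simp: s_def)
  have "inj_on s {..<l}" by (rule inj_onI) (auto simp: s_def split: if_splits)
  moreover have "inj_on f (s ` {..<l})"
    by (rule inj_on_subset[OF inj]) (use s_less in auto)
  ultimately have "inj_on (\<lambda>t. f (s t)) {..<l}"
    using comp_inj_on[of s "{..<l}" f] by (simp add: comp_def)
  moreover have "(f (s t), f (s (Suc t mod l))) \<in> E" if "t < l" for t
  proof -
    \<comment> \<open>The cases are: before the chord, the chord itself, after it, and the closing
      arc.\<close>
    consider "t < i" | "t = i" | "i < t" "Suc t < l" | "Suc t = l"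
      using \<open>t < l\<close> by (meson Suc_lessI linorder_neqE_nat)
    then show ?thesis
    proof cases
      case 1
      then show ?thesis using E[of t] l assms(2,3) by (simp add: s_def)
    next
      case 2
      then show ?thesis using assms(2,5) l by (simp add: s_def)
    next
      case 3
      then have "Suc (s t) < k" "s (Suc t) = Suc (s t)" by (auto simp: s_def l_def)
      then show ?thesis using E[of "s t"] 3 by simp
    next
      case 4
      then have "Suc (s t) = k" "s 0 = 0" using l assms(2,3) by (auto simp: s_def l_def)
      then show ?thesis using E[of "s t"] 4 by auto
    qed
  qed
  ultimately have "vertex_cycle E l (\<lambda>t. f (s t))"
    using l unfolding vertex_cycle_def by auto
  moreover have "f (s t) \<noteq> f (Suc i)" if "t < l" for t
    using inj_onD[OF inj, of "s t" "Suc i"] s_less[OF that] s_ne[of t] assms(2,3) by auto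
  then have "(\<lambda>t. f (s t)) ` {..<l} \<subseteq> f ` {..<k} - {f (Suc i)}"
    using s_less by auto
  moreover have "f (s 0) = f 0" by (simp add: s_def)
  ultimately show thesis using that by blast
qed

lemma digraph_iso_cycle_graph_if_independent:
  fixes G :: "'a pair_pre_digraph"
  assumes "pair_graph G" "card (pverts G) = n" "3 \<le> n"
    and S: "caratheodory_independent (with_proj G) S" "card S = n - 1"
  shows "digraph_iso (with_proj G) (with_proj (cycle_graph n))"
proof -
  interpret pair_graph G by fact
  have wf: "wf_digraph (with_proj G)" ..
  have SV: "S \<subseteq> pverts G" using S(1) by (simp add: caratheodory_independent_def)
  obtain p where p: "p \<in> cycle_hull (with_proj G) S" "p \<notin> S"
      "\<And>a. a \<in> S \<Longrightarrow> p \<notin> cycle_hull (with_proj G) (S - {a})"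
    by (rule caratheodory_independent_witness[OF S(1)]) (use S(2) assms(3) in auto)
  have pV: "p \<in> pverts G"
    using p(1) cycle_convex_hull[OF wf, of S] SV by (auto simp: cycle_convex_def)
  have V: "insert p S = pverts G"
  proof (rule card_subset_eq)
    have "finite S" using SV pair_finite_verts finite_subset by blast
    then show "card (insert p S) = card (pverts G)" using p(2) S(2) assms(2,3) by simp
  qed (use SV pV pair_finite_verts in auto)
  have hamiltonian: "f ` {..<k} = pverts G"
    if f: "vertex_cycle (parcs G) k f" "f 0 = p" for k f
  proof (rule ccontr)
    assume ne: "f ` {..<k} \<noteq> pverts G"
    have "f ` {..<k} \<subseteq> pverts G"
      using f(1) by (auto simp: vertex_cycle_def dest: wellformed')
    with ne obtain a where a: "a \<in> pverts G" "a \<notin> f ` {..<k}" by blast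
    have "p \<in> f ` {..<k}" using f by (force simp: vertex_cycle_def)
    with a have "a \<in> S" "p \<noteq> a" using V by auto
    have "cycle_through (with_proj G \<restriction> (S - {a} \<union> {p})) p"
      unfolding cycle_through_induce_iff
      using f \<open>f ` {..<k} \<subseteq> pverts G\<close> a V by (intro exI[of _ k] exI[of _ f]) auto
    then have "p \<in> cycle_hull (with_proj G) (S - {a})"
      using SV pV by (intro cycle_through_hull[OF wf]) auto
    with p(3)[OF \<open>a \<in> S\<close>] show False by blast
  qed
  \<comment> \<open>Otherwise the hull of \<open>S\<close> would be \<open>S\<close>, which misses
    \<open>p\<close>. Since \<open>p\<close> is the only vertex outside \<open>S\<close>, the
    violating cycle runs through \<open>p\<close>.\<close>
  have "\<not> cycle_convex (with_proj G) S"
    using p(1,2) cycle_hull_eq by metis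
  then obtain u where "u \<in> pverts G - S" "cycle_through (with_proj G \<restriction> (S \<union> {u})) u"
    using SV by (auto simp: cycle_convex_def)
  moreover from this have "u = p" using V by auto
  ultimately obtain k f where f: "vertex_cycle (parcs G) k f" "f 0 = p"
    unfolding cycle_through_induce_iff by blast
  then have inj: "inj_on f {..<k}" and E: "\<And>i. i < k \<Longrightarrow> (f i, f (Suc i mod k)) \<in> parcs G"
    unfolding vertex_cycle_def by auto
  have k: "k = n" using card_image[OF inj] hamiltonian[OF f] assms(2) by simp
  have sym: "(x, y) \<in> parcs G \<Longrightarrow> (y, x) \<in> parcs G" for x y
    using arcs_symmetric by blast
  \<comment> \<open>Any other edge would be a chord, and its shortcut a cycle through
    \<open>p\<close> avoiding \<open>f (Suc i)\<close>, against \<open>hamiltonian\<close>.\<close>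
  have chordless: "j = Suc i \<or> i = 0 \<and> j = n - 1"
    if "i < j" "j < n" "(f i, f j) \<in> parcs G" for i j
  proof (rule ccontr)
    assume "\<not> ?thesis"
    with that k obtain l g where g: "vertex_cycle (parcs G) l g" "g 0 = f 0"
      "g ` {..<l} \<subseteq> f ` {..<k} - {f (Suc i)}"
      using vertex_cycle_shortcut[OF f(1), of i j] by auto
    moreover have "f (Suc i) \<in> f ` {..<k}" using that k by auto
    ultimately show False
      using hamiltonian[OF g(1)] hamiltonian[OF f] f(2) by auto
  qed
  have "parcs G = map_prod f f ` parcs (cycle_graph n)"
  proof (intro equalityI subsetI)
    fix e assume e: "e \<in> parcs G"
    then have "fst e \<in> f ` {..<n}" "snd e \<in> f ` {..<n}"
      using hamiltonian[OF f] k arc_fst_in_verts arc_snd_in_verts by auto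
    then obtain i j where ij: "i < n" "j < n" "e = (f i, f j)" by (cases e) auto
    have "i \<noteq> j" using e ij no_loops' by blast
    then have "j = Suc i mod n \<or> i = Suc j mod n"
      using chordless[of i j] chordless[of j i] e ij sym assms(3)
      by (cases i j rule: linorder_cases) auto
    then show "e \<in> map_prod f f ` parcs (cycle_graph n)"
      using ij by (auto simp: cycle_graph_def intro!: rev_image_eqI[of "(i, j)"])
  next
    fix e assume "e \<in> map_prod f f ` parcs (cycle_graph n)"
    then show "e \<in> parcs G" using E k sym by (auto simp: cycle_graph_def)
  qed
  then show ?thesis
    using inj hamiltonian[OF f] k unfolding digraph_iso_cycle_graph_iff[OF assms(1,3)]
    by (intro exI[of _ f]) simp
qed

section \<open>From the cycle to an independent set of order \<open>n - 1\<close>\<close>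

text \<open>It suffices that the vertices on the cycle are closed under the successor modulo
  \<open>n\<close>: iterating it from one of them reaches every index.\<close>

lemma vertex_cycle_in_cycle_graph:
  assumes \<phi>: "inj_on \<phi> {..<n}"
    and f: "vertex_cycle (map_prod \<phi> \<phi> ` parcs (cycle_graph n)) k f"
  shows "f ` {..<k} = \<phi> ` {..<n}"
proof -
  have k: "3 \<le> k" and inj: "inj_on f {..<k}"
    and E: "\<And>i. i < k \<Longrightarrow> (f i, f (Suc i mod k)) \<in> map_prod \<phi> \<phi> ` parcs (cycle_graph n)"
    using f unfolding vertex_cycle_def by auto
  have sub: "f ` {..<k} \<subseteq> \<phi> ` {..<n}" using E by (fastforce simp: cycle_graph_def)
  have nbr: "j = Suc i mod n \<or> i = Suc j mod n"
    if "(\<phi> i, \<phi> j) \<in> map_prod \<phi> \<phi> ` parcs (cycle_graph n)" "i < n" "j < n" for i j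
    using that by (auto simp: cycle_graph_def inj_on_eq_iff[OF \<phi>])
  have step: "\<phi> (Suc i mod n) \<in> f ` {..<k}" if i: "i < n" "\<phi> i \<in> f ` {..<k}" for i
  proof -
    obtain a where a: "a < k" "\<phi> i = f a" using i by auto
    \<comment> \<open>\<open>b\<close> and \<open>c\<close> are the positions before and after
      \<open>a\<close> on the cycle; they differ because \<open>3 \<le> k\<close>.\<close>
    define b where "b = (if a = 0 then k - 1 else a - 1)"
    define c where "c = Suc a mod k"
    have bc: "b < k" "c < k" "Suc b mod k = a" "b \<noteq> c"
      using a k by (auto simp: b_def c_def mod_Suc)
    obtain x where x: "x < n" "f b = \<phi> x" using sub bc(1) by blast
    obtain y where y: "y < n" "f c = \<phi> y" using sub bc(2) by blast
    have "x \<noteq> y" using inj_onD[OF inj, of b c] bc x y by auto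
    have "i = Suc x mod n \<or> x = Suc i mod n"
      using nbr[of x i] E[OF bc(1)] bc(3) a x i by auto
    moreover have "y = Suc i mod n \<or> i = Suc y mod n"
      using nbr[of i y] E[OF a(1)] a y i by (auto simp: c_def)
    \<comment> \<open>The distinct neighbours \<open>x\<close> and \<open>y\<close> of
      \<open>i\<close> cannot both be its predecessor, so one of them is its successor.\<close>
    moreover have "\<not> (i = Suc x mod n \<and> i = Suc y mod n)"
      using \<open>x \<noteq> y\<close> x y by (auto simp: mod_Suc split: if_splits)
    ultimately have "x = Suc i mod n \<or> y = Suc i mod n" by blast
    then show ?thesis using x(2) y(2) bc(1,2) by (metis imageI lessThan_iff)
  qed
  obtain i0 where i0: "i0 < n" "\<phi> i0 = f 0"
  proof -
    have "f 0 \<in> \<phi> ` {..<n}" using sub k by (auto simp: image_subset_iff)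
    then show thesis using that by auto
  qed
  have "\<phi> ((i0 + d) mod n) \<in> f ` {..<k}" for d
  proof (induction d)
    case 0
    show ?case using i0 k by auto
  next
    case (Suc d)
    have "(i0 + d) mod n < n" using i0 by simp
    from step[OF this Suc.IH] show ?case by (simp add: mod_Suc_eq)
  qed
  note reach = this
  have "\<phi> j \<in> f ` {..<k}" if "j < n" for j
    \<comment> \<open>This number of steps leads from \<open>i0\<close> to \<open>n + j\<close>,
      which is \<open>j\<close> modulo \<open>n\<close>.\<close>
    using reach[of "n - i0 + j"] that i0 by simp
  with sub show ?thesis by auto
qed

lemma caratheodory_independent_if_digraph_iso_cycle_graph:
  fixes G :: "'a pair_pre_digraph"
  assumes "pair_graph G" "3 \<le> n"
    and iso: "digraph_iso (with_proj G) (with_proj (cycle_graph n))"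
  obtains S where "caratheodory_independent (with_proj G) S" "card S = n - 1"
proof -
  interpret pair_graph G by fact
  have wf: "wf_digraph (with_proj G)" ..
  obtain \<phi> where \<phi>: "inj_on \<phi> {..<n}" "pverts G = \<phi> ` {..<n}"
      "parcs G = map_prod \<phi> \<phi> ` parcs (cycle_graph n)"
    using iso digraph_iso_cycle_graph_iff[OF assms(1,2)] by blast
  \<comment> \<open>Every cycle covers all of \<open>pverts G\<close>, so none fits into a set that
    misses a vertex.\<close>
  have no_cycle: "\<not> cycle_through (with_proj G \<restriction> X) u" if "\<not> pverts G \<subseteq> X" for X u
    using that vertex_cycle_in_cycle_graph[OF \<phi>(1)] \<phi>(2,3) unfolding cycle_through_induce_iff
    by metis
  \<comment> \<open>With this choice \<open>\<phi>\<close> itself is a cycle that starts at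
    \<open>p\<close>.\<close>
  define p where "p = \<phi> 0"
  define S where "S = pverts G - {p}"
  have pV: "p \<in> pverts G" using \<phi>(2) assms(2) by (auto simp: p_def)
  have "vertex_cycle (parcs G) n \<phi>"
    using \<phi>(1,3) assms(2) by (auto simp: vertex_cycle_def cycle_graph_def)
  then have "cycle_through (with_proj G \<restriction> (S \<union> {p})) p"
    unfolding cycle_through_induce_iff using \<phi>(2)
    by (intro exI[of _ n] exI[of _ \<phi>]) (auto simp: p_def S_def)
  then have "p \<in> cycle_hull (with_proj G) S"
    using pV by (intro cycle_through_hull[OF wf]) (auto simp: S_def)
  moreover have "p \<notin> cycle_hull (with_proj G) (S - {a})" if "a \<in> S" for a
  proof -
    \<comment> \<open>The set \<open>S - {a}\<close> misses both \<open>p\<close> and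
      \<open>a\<close>, so adding a single vertex \<open>u\<close> still leaves one out.\<close>
    have "\<not> pverts G \<subseteq> S - {a} \<union> {u}" for u
      using that pV by (auto simp: S_def)
    then have "cycle_convex (with_proj G) (S - {a})"
      using no_cycle by (auto simp: cycle_convex_def S_def)
    then show ?thesis by (simp add: cycle_hull_eq S_def)
  qed
  ultimately have "caratheodory_independent (with_proj G) S"
    by (auto simp: caratheodory_independent_def S_def)
  moreover have "card S = n - 1"
    using pV \<phi>(1,2) by (simp add: S_def card_image)
  ultimately show thesis using that by blast
qed

theorem theorem4p8:
  fixes G :: "'a pair_pre_digraph" and n :: nat
  assumes "pair_graph G"
    and "Digraph_Component.connected (with_proj G)"
    and "card (pverts G) = n"
    and "3 \<le> n"
  shows "caratheodory_number (with_proj G) = n - 1 \<longleftrightarrow>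
         digraph_iso (with_proj G) (with_proj (cycle_graph n))"
proof -
  have "2 \<le> n" using assms(4) by simp
  show ?thesis
    unfolding caratheodory_number_eq_card_minus_1_iff[OF assms(1,3) \<open>2 \<le> n\<close>]
    using digraph_iso_cycle_graph_if_independent[OF assms(1,3,4)]
      caratheodory_independent_if_digraph_iso_cycle_graph[OF assms(1,4)] by metis
qed

end
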